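(* For all integers $n,k>0$, $$(-1)^{k} \left(Q_2(n) - \sum_{j=0}^{2k-1} (-1)^{j(j+1)/2}\, pod\big(n-j(j+1)\big) \right) = \sum_{j=0}^{\left\lfloor n/2 \right\rfloor} Q_2(n-2j)\, MP_k(j).$$
   Context: A partition of $n$ is a nonincreasing sequence of positive integers (called parts) with sum $n$; the empty partition is the only partition of $0$. $pod(n)$ is the number of partitions of $n$ in which odd parts are distinct and even parts are unrestricted; $pod(0)=1$ and $pod(x)=0$ if $x$ is not a nonnegative integer. $Q_2(n)$ is the number of partitions of $n$ into distinct parts none of which is congruent to $2$ modulo $4$; $Q_2(0)=1$. $MP_k(n)$ is the number of partitions of $n$ in which the first part larger than $2k-1$ (that is, the smallest part size exceeding $2k-1$, which must exist) is odd and appears exactly $k$ times, and all other odd parts appear at most once; in particular $MP_k(0)=0$. For example $MP_2(19)=10$. Equivalently, $$\sum_{n=0}^\infty MP_k(n)\, q^n = \frac{(-q;q^2)_k}{(q^2;q^2)_{k-1}} \sum_{j=k}^{\infty} \frac{q^{k(2j+1)}\,(-q^{2j+3};q^2)_\infty}{(q^{2j+2};q^2)_\infty},$$ where $(a;q)_m=\prod_{i=0}^{m-1}(1-aq^i)$ and $(a;q)_\infty=\prod_{i\geqslant 0}(1-aq^i)$. *)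

theory Defs
  imports Complex_Main
begin

definition is_partition :: "nat \<Rightarrow> nat list \<Rightarrow> bool" where
  "is_partition n p \<longleftrightarrow> sorted_wrt (\<ge>) p \<and> (\<forall>x\<in>set p. 0 < x) \<and> sum_list p = n"

(* The counting functions below are cardinalities; this guards against the
   convention that infinite sets have cardinality 0. *)
lemma finite_partitions: "finite {p. is_partition n p}"
proof (rule finite_subset)
  have "length p \<le> sum_list p" if "\<forall>x\<in>set p. 0 < x" for p :: "nat list"
    using that by (induction p) (auto simp: Suc_le_eq)
  then show "{p. is_partition n p} \<subseteq> {p. set p \<subseteq> {..n} \<and> length p \<le> n}"
    by (auto simp: is_partition_def intro: member_le_sum_list)
  show "finite {p. set p \<subseteq> {..n} \<and> length p \<le> n}"
    by (rule finite_lists_length_le) simp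
qed

(* The argument is an integer because pod is evaluated at differences n - j(j+1),
   which may be negative; pod vanishes there. *)
definition pod :: "int \<Rightarrow> nat" where
  "pod m = (if m < 0 then 0
     else card {p. is_partition (nat m) p \<and> (\<forall>x\<in>set p. odd x \<longrightarrow> count_list p x = 1)})"

definition Q2 :: "nat \<Rightarrow> nat" where
  "Q2 n = card {p. is_partition n p \<and> distinct p \<and> (\<forall>x\<in>set p. x mod 4 \<noteq> 2)}"

(* Here m is the smallest part size exceeding 2k-1, required to exist.  Meaningful only for
   k > 0, as 2 * k - 1 is truncated subtraction. *)
definition MP :: "nat \<Rightarrow> nat \<Rightarrow> nat" where
  "MP k n = card {p. is_partition n p \<and>
     (\<exists>m\<in>set p. 2 * k - 1 < m \<and> (\<forall>x\<in>set p. 2 * k - 1 < x \<longrightarrow> m \<le> x) \<and>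
        odd m \<and> count_list p m = k \<and>
        (\<forall>x\<in>set p. odd x \<and> x \<noteq> m \<longrightarrow> count_list p x \<le> 1))}"

end

theory Submission
  imports Defs "HOL-Library.Multiset" "HOL-Computational_Algebra.Formal_Power_Series"
begin

text \<open>
  Write \<open>P(q)\<close>, \<open>Q(q)\<close> and \<open>M\<^sub>k(q)\<close> for the generating functions of \<open>pod\<close>, \<open>Q\<^sub>2\<close> and
  \<open>MP\<^sub>k\<close>, and \<open>\<psi>\<^sub>m(q)\<close> for the sum of \<open>(-q)\<close> to the power \<open>j (j + 1) / 2\<close> over \<open>j < m\<close>.  The
  theorem is the equality of the coefficients of \<open>q\<close> to the power \<open>n\<close> in
    \<open>(-1)\<^sup>k (Q(q) - P(q) \<psi>\<^sub>2\<^sub>k(q\<^sup>2)) = Q(q) M\<^sub>k(q\<^sup>2)\<close>,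
  and it follows from two identities of formal power series:

  (a) \<open>P(x) \<psi>\<^sub>2\<^sub>k(x) = 1 - (-1)\<^sup>k M\<^sub>k(x)\<close>, a truncation of the theorem of Gauss on the
  triangular numbers (lemma \<open>truncated_gauss\<close>);

  (b) \<open>Q(q) P(q\<^sup>2) = P(q)\<close> (lemma \<open>Q2_gf_mult_pod_gf\<close>).

  Indeed, substitute \<open>x = q\<^sup>2\<close> in (a), multiply by \<open>Q(q)\<close> and simplify by (b).

  For (a), let \<open>R\<^sub>m\<close> count the partitions counted by \<open>pod\<close> with all parts above \<open>m\<close>, and let
  \<open>W\<^sub>m\<close> count those with all parts at most \<open>m\<close>, so that \<open>P = W\<^sub>m R\<^sub>m\<close>.  Sorting the partitions
  counted by \<open>MP\<^sub>k\<close> by their first part \<open>2 j + 1\<close> above \<open>2 k - 1\<close> shows that \<open>M\<^sub>k\<close> is \<open>W\<close> with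
  index \<open>2 k - 1\<close> times the sum over \<open>j \<ge> k\<close> of \<open>x\<close> to the power \<open>k (2 j + 1)\<close> times \<open>R\<close> with index
  \<open>2 j + 1\<close>.  In the combination of two consecutive such sums that occurs in \<open>M\<^sub>k + M\<^sub>k\<^sub>+\<^sub>1\<close> the
  terms telescope (lemma \<open>MP_tail_telescope\<close>), which leaves \<open>x\<close> to the power \<open>k (2 k + 1)\<close>
  times \<open>(1 - x\<^sup>2\<^sup>k\<^sup>+\<^sup>1) P\<close>.  Up to the sign \<open>(-1)\<^sup>k\<close> that is \<open>P\<close> times the two terms by which
  \<open>\<psi>\<close> grows when \<open>k\<close> does, so (a) follows by induction on \<open>k\<close>.

  Identity (b) is a regrouping of Euler products whose only ingredient is
  \<open>(1 + q\<^sup>i) / (1 - q\<^sup>2\<^sup>i) = 1 / (1 - q\<^sup>i)\<close> for even \<open>i\<close>.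

  All infinite sums and products are avoided: to compare the coefficients of one degree it
  is enough to keep finitely many part sizes (lemma \<open>partition_gf_nth_prod\<close>).
\<close>

unbundle fps_syntax

section \<open>Generating functions of partitions with prescribed multiplicities\<close>

text \<open>
  A restriction on partitions is encoded by the set \<open>A i\<close> of multiplicities allowed for each part
  size \<open>i > 0\<close>.  All classes of partitions below restrict the part sizes independently of each
  other, or are disjoint unions of such classes, so their generating functions are sums
  of products over the part sizes.
\<close>
definition partitions_with :: "(nat \<Rightarrow> nat set) \<Rightarrow> nat \<Rightarrow> nat multiset set" where
  "partitions_with A n = {M. 0 \<notin># M \<and> sum_mset M = n \<and> (\<forall>i>0. count M i \<in> A i)}"

definition partition_gf :: "(nat \<Rightarrow> nat set) \<Rightarrow> int fps" where
  "partition_gf A = Abs_fps (\<lambda>n. int (card (partitions_with A n)))"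

text \<open>The Euler factor of a part size \<open>i > 0\<close>: the sum of \<open>x\<^sup>i\<^sup>a\<close> over the multiplicities \<open>a\<close> in \<open>S\<close>.\<close>
definition part_gf :: "nat \<Rightarrow> nat set \<Rightarrow> int fps" where
  "part_gf i S = Abs_fps (\<lambda>n. if \<exists>a\<in>S. n = i * a then 1 else 0)"

lemma is_partition_iff_mset:
  "is_partition n p \<longleftrightarrow> sorted_wrt (\<ge>) p \<and> 0 \<notin># mset p \<and> sum_mset (mset p) = n"
  by (auto simp: is_partition_def sum_mset_sum_list intro: gr0I)

text \<open>A nonincreasing list is determined by its multiset of entries, so order can be forgotten.\<close>
lemma bij_betw_mset_partitions:
  "bij_betw mset {p. is_partition n p \<and> Q (mset p)}
     {M. 0 \<notin># M \<and> sum_mset M = n \<and> Q M}"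
proof (rule bij_betwI')
  fix p r
  assume "p \<in> {p. is_partition n p \<and> Q (mset p)}" "r \<in> {p. is_partition n p \<and> Q (mset p)}"
  then have s: "sorted (rev p)" "sorted (rev r)"
    by (simp_all add: is_partition_def sorted_wrt_rev)
  show "mset p = mset r \<longleftrightarrow> p = r"
  proof
    assume "mset p = mset r"
    then have "rev p = rev r"
      using s by (metis mset_rev properties_for_sort)
    then show "p = r" by simp
  qed simp
next
  fix M :: "nat multiset"
  assume M: "M \<in> {M. 0 \<notin># M \<and> sum_mset M = n \<and> Q M}"
  have "sorted_wrt (\<ge>) (rev (sorted_list_of_multiset M))"
    by (simp add: sorted_wrt_rev)
  then show "\<exists>p\<in>{p. is_partition n p \<and> Q (mset p)}. M = mset p"
    using M by (intro bexI[of _ "rev (sorted_list_of_multiset M)"])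
       (auto simp: is_partition_iff_mset)
qed (auto simp: is_partition_iff_mset)

lemma card_partitions_eq_mset:
  "card {p. is_partition n p \<and> Q (mset p)} = card {M. 0 \<notin># M \<and> sum_mset M = n \<and> Q M}"
  using bij_betw_mset_partitions by (rule bij_betw_same_card)

lemma finite_partitions_with: "finite (partitions_with A n)"
proof -
  have "finite {p. is_partition n p \<and> (\<forall>i>0. count (mset p) i \<in> A i)}"
    by (rule finite_subset[OF _ finite_partitions[of n]]) auto
  then show ?thesis
    unfolding partitions_with_def
    using bij_betw_finite[OF bij_betw_mset_partitions[of n "\<lambda>M. \<forall>i>0. count M i \<in> A i"]] by simp
qed

lemma count_mult_le_sum_mset: "count M i * i \<le> sum_mset M" for i :: nat
  by (induction M) auto

lemma member_le_sum_mset: "i \<in># M \<Longrightarrow> i \<le> sum_mset M" for i :: nat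
  by (induction M) auto

text \<open>
  A partition amounts to the multiplicity \<open>a\<close> of \<open>i\<close> together with the partition of \<open>n - i a\<close>
  that remains when all copies of \<open>i\<close> are removed.
\<close>
lemma partition_gf_split:
  assumes "i > 0"
  shows "partition_gf A = part_gf i (A i) * partition_gf (A(i := {0}))"
proof (rule fps_ext)
  fix n
  let ?B = "A(i := {0})"
  define C where "C s = {M \<in> partitions_with A n. i * count M i = s}" for s
  have le: "i * count M i \<le> n" if "M \<in> partitions_with A n" for M
    using that count_mult_le_sum_mset[of M i] by (auto simp: partitions_with_def mult.commute)
  have "partitions_with A n = (\<Union>s\<in>{0..n}. C s)"
    using le by (auto simp: C_def)
  then have "card (partitions_with A n) = (\<Sum>s=0..n. card (C s))"
    by (simp only:) (rule card_UN_disjoint, auto simp: C_def intro: finite_subset[OF _ finite_partitions_with[of A n]])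
  moreover have "int (card (C s)) = part_gf i (A i) $ s * partition_gf ?B $ (n - s)"
    if s: "s \<le> n" for s
  proof (cases "\<exists>a\<in>A i. s = i * a")
    case True
    then obtain a where a: "a \<in> A i" "s = i * a" by blast
    have "bij_betw (\<lambda>M. M + replicate_mset a i) (partitions_with ?B (n - s)) (C s)"
    proof (rule bij_betw_byWitness[where f' = "filter_mset (\<lambda>x. x \<noteq> i)"])
      show "\<forall>M\<in>partitions_with ?B (n - s). filter_mset (\<lambda>x. x \<noteq> i) (M + replicate_mset a i) = M"
        using assms by (auto simp: partitions_with_def multiset_eq_iff)
      show "\<forall>M\<in>C s. filter_mset (\<lambda>x. x \<noteq> i) M + replicate_mset a i = M"
        using assms a by (auto simp: C_def multiset_eq_iff)
      show "(\<lambda>M. M + replicate_mset a i) ` partitions_with ?B (n - s) \<subseteq> C s"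
        using assms a s by (auto simp: C_def partitions_with_def mult.commute split: if_splits)
      show "filter_mset (\<lambda>x. x \<noteq> i) ` C s \<subseteq> partitions_with ?B (n - s)"
      proof (rule image_subsetI)
        fix M assume M: "M \<in> C s"
        then have "count M i = a" using assms a by (auto simp: C_def)
        then have "M = filter_mset (\<lambda>x. x \<noteq> i) M + replicate_mset a i"
          by (auto simp: multiset_eq_iff)
        then have "sum_mset M = sum_mset (filter_mset (\<lambda>x. x \<noteq> i) M) + s"
          using a by (metis sum_mset.union sum_mset_replicate_mset of_nat_id mult.commute)
        then show "filter_mset (\<lambda>x. x \<noteq> i) M \<in> partitions_with ?B (n - s)"
          using M by (auto simp: C_def partitions_with_def)
      qed
    qed
    then have "card (C s) = card (partitions_with ?B (n - s))"
      using bij_betw_same_card by metis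
    with True show ?thesis by (simp add: part_gf_def partition_gf_def)
  next
    case False
    then have "C s = {}"
      using assms by (auto simp: C_def partitions_with_def)
    with False show ?thesis by (simp add: part_gf_def)
  qed
  ultimately show "partition_gf A $ n = (part_gf i (A i) * partition_gf ?B) $ n"
    by (simp add: partition_gf_def fps_mult_nth)
qed

lemma partition_gf_cong:
  assumes "\<And>i. i > 0 \<Longrightarrow> A i = B i"
  shows "partition_gf A = partition_gf B"
proof -
  have "partitions_with A n = partitions_with B n" for n
    using assms by (auto simp: partitions_with_def)
  then show ?thesis by (simp add: partition_gf_def)
qed

lemma partition_gf_split_finite:
  assumes "finite I" "0 \<notin> I"
  shows "partition_gf A
       = (\<Prod>i\<in>I. part_gf i (A i)) * partition_gf (\<lambda>i. if i \<in> I then {0} else A i)"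
  using assms
proof (induction I rule: finite_induct)
  case empty
  then show ?case by simp
next
  case (insert j I)
  let ?A = "\<lambda>i. if i \<in> I then {0} else A i"
  have "partition_gf ?A = part_gf j (A j) * partition_gf (?A(j := {0}))"
    using partition_gf_split[of j ?A] insert by simp
  moreover have "?A(j := {0}) = (\<lambda>i. if i \<in> insert j I then {0} else A i)"
    by (rule ext) simp
  ultimately show ?case using insert by (simp add: mult_ac)
qed

text \<open>If all parts must exceed \<open>N\<close>, then only the empty partition has size at most \<open>N\<close>.\<close>
lemma partition_gf_nth_low:
  assumes zero: "\<And>i. i > 0 \<Longrightarrow> 0 \<in> A i"
    and low: "\<And>i. 0 < i \<Longrightarrow> i \<le> N \<Longrightarrow> A i = {0}"
    and "n \<le> N"
  shows "partition_gf A $ n = (if n = 0 then 1 else 0)"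
proof -
  have "M = {#}" if "M \<in> partitions_with A n" for M
  proof (rule ccontr)
    assume "M \<noteq> {#}"
    then obtain i where i: "i \<in># M" by blast
    then have "i \<le> n" "i > 0"
      using that member_le_sum_mset[OF i] by (auto simp: partitions_with_def intro!: gr0I)
    then have "count M i = 0"
      using that low[of i] \<open>n \<le> N\<close> by (auto simp: partitions_with_def)
    with i show False by (simp add: count_eq_zero_iff)
  qed
  then have "partitions_with A n = (if n = 0 then {{#}} else {})"
    using zero by (cases "n = 0") (fastforce simp: partitions_with_def)+
  then show ?thesis by (simp add: partition_gf_def)
qed

lemma fps_mult_nth_cong:
  fixes f g :: "'a::semiring_0 fps"
  assumes "\<And>m. m \<le> n \<Longrightarrow> f $ m = f' $ m" "\<And>m. m \<le> n \<Longrightarrow> g $ m = g' $ m"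
  shows "(f * g) $ n = (f' * g') $ n"
  using assms by (simp add: fps_mult_nth)

text \<open>
  The finite form of the Euler product: part sizes above \<open>N\<close> cannot influence coefficients up to
  \<open>N\<close>.  The index set may contain further part sizes, which is what makes the finite
  regrouping in \<open>finite_product_Q2_pod\<close> below exact.
\<close>
lemma partition_gf_nth_prod:
  assumes "finite I" "0 \<notin> I" "{1..N} \<subseteq> I" "\<And>i. i > 0 \<Longrightarrow> 0 \<in> A i" "n \<le> N"
  shows "partition_gf A $ n = (\<Prod>i\<in>I. part_gf i (A i)) $ n"
proof -
  let ?R = "partition_gf (\<lambda>i. if i \<in> I then {0} else A i)"
  have "?R $ m = (1 :: int fps) $ m" if "m \<le> n" for m
    using assms that by (subst partition_gf_nth_low[where N = N]) (auto simp: subset_iff)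
  then have "((\<Prod>i\<in>I. part_gf i (A i)) * ?R) $ n = ((\<Prod>i\<in>I. part_gf i (A i)) * 1) $ n"
    by (intro fps_mult_nth_cong) auto
  then show ?thesis
    using partition_gf_split_finite[OF assms(1,2), of A] by simp
qed

lemma part_gf_zero: "part_gf i {0} = 1"
  by (rule fps_ext) (simp add: part_gf_def)

lemma part_gf_singleton: "part_gf i {k} = fps_X ^ (i * k)"
  by (rule fps_ext) (simp add: part_gf_def fps_X_power_iff)

lemma part_gf_at_most_once: "i > 0 \<Longrightarrow> part_gf i {0, 1} = 1 + fps_X ^ i"
  by (rule fps_ext) (auto simp: part_gf_def fps_X_power_iff)

lemma part_gf_UNIV:
  assumes "i > 0"
  shows "part_gf i UNIV * (1 - fps_X ^ i) = 1"
proof (rule fps_ext)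
  fix n
  have "(\<exists>a. n = i * a) \<longleftrightarrow> i dvd n" for n
    by (auto simp: dvd_def)
  moreover have "i dvd n - i \<longleftrightarrow> i dvd n" if "i \<le> n"
    using that by (metis dvd_diff_nat dvd_refl dvd_diffD)
  ultimately show "(part_gf i UNIV * (1 - fps_X ^ i)) $ n = (1 :: int fps) $ n"
    using assms by (auto simp: part_gf_def right_diff_distrib fps_X_power_mult_right_nth dest: dvd_imp_le)
qed

section \<open>Partitions with distinct odd parts\<close>

definition pod_mult :: "nat \<Rightarrow> nat set" where
  "pod_mult i = (if odd i then {0, 1} else UNIV)"

definition pod_above :: "nat \<Rightarrow> int fps" where
  "pod_above m = partition_gf (\<lambda>i. if i \<le> m then {0} else pod_mult i)"

definition pod_upto :: "nat \<Rightarrow> int fps" where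
  "pod_upto m = (\<Prod>i=1..m. part_gf i (pod_mult i))"

lemma pod_upto_odd: "pod_upto (2 * j + 1) = pod_upto (2 * j) * (1 + fps_X ^ (2 * j + 1))"
  by (simp add: pod_upto_def pod_mult_def part_gf_at_most_once[simplified])

lemma pod_upto_even: "pod_upto (2 * j + 2) * (1 - fps_X ^ (2 * j + 2)) = pod_upto (2 * j + 1)"
  using part_gf_UNIV[of "2 * j + 2"] by (simp add: pod_upto_def pod_mult_def mult.assoc)

lemma pod_upto_mult_pod_above: "partition_gf pod_mult = pod_upto m * pod_above m"
proof -
  have "partition_gf (\<lambda>i. if i \<in> {1..m} then {0} else pod_mult i) = pod_above m"
    unfolding pod_above_def by (rule partition_gf_cong) auto
  then show ?thesis
    using partition_gf_split_finite[of "{1..m}" pod_mult] by (simp add: pod_upto_def)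
qed

lemma pod_above_step: "pod_above m = part_gf (Suc m) (pod_mult (Suc m)) * pod_above (Suc m)"
proof -
  have "(\<lambda>i. if i \<le> m then {0} else pod_mult i)(Suc m := {0})
      = (\<lambda>i. if i \<le> Suc m then {0} else pod_mult i)"
    by (rule ext) (simp add: le_Suc_eq)
  then show ?thesis
    using partition_gf_split[of "Suc m" "\<lambda>i. if i \<le> m then {0} else pod_mult i"]
    by (simp add: pod_above_def)
qed

lemma pod_above_even: "pod_above (2 * j) = (1 + fps_X ^ (2 * j + 1)) * pod_above (2 * j + 1)"
  using pod_above_step[of "2 * j"] by (simp add: pod_mult_def part_gf_at_most_once[simplified])

lemma pod_above_odd: "pod_above (2 * j + 1) * (1 - fps_X ^ (2 * j + 2)) = pod_above (2 * j + 2)"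
proof -
  have "pod_above (2 * j + 1) = part_gf (2 * j + 2) UNIV * pod_above (2 * j + 2)"
    using pod_above_step[of "2 * j + 1"] by (simp add: pod_mult_def)
  then have "pod_above (2 * j + 1) * (1 - fps_X ^ (2 * j + 2))
      = (part_gf (2 * j + 2) UNIV * (1 - fps_X ^ (2 * j + 2))) * pod_above (2 * j + 2)"
    by (simp only: mult_ac)
  moreover have "part_gf (2 * j + 2) UNIV * (1 - fps_X ^ (2 * j + 2)) = 1"
    by (rule part_gf_UNIV) simp
  ultimately show ?thesis by (simp only: mult_1)
qed

lemma pod_above_nth_low: "n \<le> m \<Longrightarrow> pod_above m $ n = (if n = 0 then 1 else 0)"
  unfolding pod_above_def by (rule partition_gf_nth_low) (auto simp: pod_mult_def)

section \<open>The telescoping sum\<close>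

text \<open>
  The sum over the possible first parts \<open>2 j + 1\<close>, used exactly \<open>k\<close> times, of which only those
  with \<open>j < J\<close> matter for coefficients up to \<open>2 J\<close> when \<open>k > 0\<close>.
\<close>
definition MP_tail :: "nat \<Rightarrow> nat \<Rightarrow> int fps" where
  "MP_tail k J = (\<Sum>j=k..<J. fps_X ^ (k * (2 * j + 1)) * pod_above (2 * j + 1))"

text \<open>
  With \<open>a\<^sub>j\<close> denoting \<open>x\<close> to the power \<open>k (2 j + 1)\<close> times the series \<open>pod_above (2 j)\<close>, and with
  the second sum extended to \<open>j = k\<close>, the \<open>j\<close>-th terms of the left-hand side add up to
  \<open>a\<^sub>j - a\<^sub>j\<^sub>+\<^sub>1\<close>: \<open>pod_above (2 j)\<close> and \<open>pod_above (2 j + 2)\<close> are \<open>pod_above (2 j + 1)\<close> times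
  \<open>1 + x\<^sup>2\<^sup>j\<^sup>+\<^sup>1\<close> and \<open>1 - x\<^sup>2\<^sup>j\<^sup>+\<^sup>2\<close>, respectively.  The extra term for \<open>j = k\<close> equals
  \<open>x\<^sup>2\<^sup>k\<^sup>+\<^sup>1 a\<^sub>k\<close>.  The case \<open>k = 0\<close> is included because it starts the induction for
  \<open>truncated_gauss\<close>.
\<close>
lemma MP_tail_telescope:
  assumes "k < J"
  shows "(1 - fps_X ^ (2 * k)) * MP_tail k J + (1 + fps_X ^ (2 * k + 1)) * MP_tail (Suc k) J
       = fps_X ^ (k * (2 * k + 1)) * (1 - fps_X ^ (2 * k + 1)) * pod_above (2 * k)
         - fps_X ^ (k * (2 * J + 1)) * pod_above (2 * J)"
proof -
  \<comment> \<open>The powers of \<open>x\<close> are replaced by variables, so that ring normalization cannot split them.\<close>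
  have collect: "p * t + q * t' = (1 - v) * x - y"
    if "p * t + q * s' = x - y" "s' = c + t'" "q * c = v * x" for p q t t' s' c v x y :: "int fps"
    using that by (simp add: algebra_simps)
  define a where "a j = fps_X ^ (k * (2 * j + 1)) * pod_above (2 * j)" for j
  define b where "b l j = fps_X ^ (l * (2 * j + 1)) * pod_above (2 * j + 1)" for l j
  have b: "b (Suc k) j = fps_X ^ (k * (2 * j + 1)) * fps_X ^ (2 * j + 1) * pod_above (2 * j + 1)" for j
    by (simp add: b_def power_add mult_ac)
  have step: "(1 - fps_X ^ (2 * k)) * b k j + (1 + fps_X ^ (2 * k + 1)) * b (Suc k) j = a j - a (Suc j)" for j
  proof -
    have "a (Suc j) = fps_X ^ (k * (2 * j + 1)) * fps_X ^ (2 * k) * pod_above (2 * j + 2)"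
      by (simp add: a_def power_add[symmetric] algebra_simps)
    also have "\<dots> = fps_X ^ (k * (2 * j + 1)) * fps_X ^ (2 * k)
        * (pod_above (2 * j + 1) * (1 - fps_X ^ (2 * j + 1) * fps_X))"
      using pod_above_odd[of j] by (simp add: mult_ac)
    finally have "a (Suc j) = \<dots>" .
    moreover have "a j = fps_X ^ (k * (2 * j + 1)) * ((1 + fps_X ^ (2 * j + 1)) * pod_above (2 * j + 1))"
      by (simp only: a_def pod_above_even)
    ultimately show ?thesis
      unfolding b by (simp only: b_def) (simp add: algebra_simps)
  qed
  have "(\<Sum>j=k..<J. a j - a (Suc j)) = a k - a J"
    using assms sum_Suc_diff'[of k J "\<lambda>j. - a j"] by simp
  then have total: "(1 - fps_X ^ (2 * k)) * (\<Sum>j=k..<J. b k j)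
      + (1 + fps_X ^ (2 * k + 1)) * (\<Sum>j=k..<J. b (Suc k) j) = a k - a J"
    by (simp only: step[symmetric] sum.distrib sum_distrib_left)
  have "(\<Sum>j=k..<J. b k j) = MP_tail k J"
    by (simp add: b_def MP_tail_def)
  with total have "(1 - fps_X ^ (2 * k)) * MP_tail k J
      + (1 + fps_X ^ (2 * k + 1)) * MP_tail (Suc k) J = (1 - fps_X ^ (2 * k + 1)) * a k - a J"
  proof (intro collect)
    show "(\<Sum>j=k..<J. b (Suc k) j) = b (Suc k) k + MP_tail (Suc k) J"
      using assms by (simp add: sum.atLeast_Suc_lessThan b_def MP_tail_def)
    show "(1 + fps_X ^ (2 * k + 1)) * b (Suc k) k = fps_X ^ (2 * k + 1) * a k"
      unfolding b by (simp only: a_def pod_above_even) (simp add: algebra_simps)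
  qed simp
  then show ?thesis
    by (simp only: a_def mult_ac)
qed

section \<open>The generating function of MP\<close>

definition MP_gf :: "nat \<Rightarrow> int fps" where
  "MP_gf k = Abs_fps (\<lambda>n. int (MP k n))"

text \<open>
  The restriction for the partitions counted by \<open>MP k\<close> in which \<open>2 j + 1\<close> is the first part above
  \<open>2 k - 1\<close>: sizes between these two bounds are forbidden.
\<close>
definition MP_mult :: "nat \<Rightarrow> nat \<Rightarrow> nat \<Rightarrow> nat set" where
  "MP_mult k j i = (if i = 2 * j + 1 then {k}
     else if i < 2 * k \<or> 2 * j + 1 < i then pod_mult i else {0})"

lemma partition_gf_MP_mult:
  assumes "0 < k" "k \<le> j"
  shows "partition_gf (MP_mult k j)
       = pod_upto (2 * k - 1) * (fps_X ^ (k * (2 * j + 1)) * pod_above (2 * j + 1))"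
proof -
  let ?I = "insert (2 * j + 1) {1..2 * k - 1}"
  have "partition_gf (\<lambda>i. if i \<in> ?I then {0} else MP_mult k j i) = pod_above (2 * j + 1)"
    unfolding pod_above_def using assms by (intro partition_gf_cong) (auto simp: MP_mult_def)
  moreover have "(\<Prod>i=1..2*k-1. part_gf i (MP_mult k j i)) = pod_upto (2 * k - 1)"
    unfolding pod_upto_def using assms by (intro prod.cong) (auto simp: MP_mult_def)
  moreover have "part_gf (2 * j + 1) (MP_mult k j (2 * j + 1)) = fps_X ^ (k * (2 * j + 1))"
    by (simp add: MP_mult_def part_gf_singleton mult.commute)
  ultimately show ?thesis
    using partition_gf_split_finite[of ?I "MP_mult k j"] assms by (simp add: mult_ac)
qed

text \<open>The first part above \<open>2 k - 1\<close> is unique, so the partitions can be sorted by it.\<close>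
lemma card_MP:
  assumes "0 < k" "n \<le> 2 * J"
  shows "MP k n = (\<Sum>j=k..<J. card (partitions_with (MP_mult k j) n))"
proof -
  define Q where "Q M m \<longleftrightarrow> 2 * k - 1 < m \<and> (\<forall>x\<in>#M. 2 * k - 1 < x \<longrightarrow> m \<le> x) \<and> odd m \<and>
      count M m = k \<and> (\<forall>x\<in>#M. odd x \<and> x \<noteq> m \<longrightarrow> count M x \<le> 1)" for M m
  have Q_iff: "2 * j + 1 \<in># M \<and> Q M (2 * j + 1) \<longleftrightarrow> k \<le> j \<and> (\<forall>i>0. count M i \<in> MP_mult k j i)"
    if M: "0 \<notin># M" for M j
  proof
    assume L: "2 * j + 1 \<in># M \<and> Q M (2 * j + 1)"
    then have "k \<le> j" by (auto simp: Q_def)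
    moreover have "count M i \<in> MP_mult k j i" if "i > 0" for i
    proof (cases "i \<in># M \<and> i \<noteq> 2 * j + 1")
      case True
      then have "odd i \<Longrightarrow> count M i \<le> 1" and m: "2 * k - 1 < i \<Longrightarrow> 2 * j + 1 \<le> i"
        using L by (auto simp: Q_def)
      then have "count M i \<in> pod_mult i"
        by (cases "count M i") (auto simp: pod_mult_def)
      moreover have "2 * j + 1 < i" if "\<not> i < 2 * k"
      proof -
        have "2 * k - 1 < i" using that assms(1) by linarith
        with m True show ?thesis by (simp add: le_less)
      qed
      ultimately show ?thesis using True by (auto simp: MP_mult_def)
    next
      case False
      then show ?thesis
        using L by (auto simp: Q_def MP_mult_def pod_mult_def not_in_iff)
    qed
    ultimately show "k \<le> j \<and> (\<forall>i>0. count M i \<in> MP_mult k j i)" by blast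
  next
    assume R: "k \<le> j \<and> (\<forall>i>0. count M i \<in> MP_mult k j i)"
    then have cnt: "count M (2 * j + 1) = k"
      by (auto simp: MP_mult_def dest!: spec[of _ "2 * j + 1"])
    moreover have "2 * j + 1 \<le> x" if "x \<in># M" "2 * k - 1 < x" for x
    proof (rule ccontr)
      assume "\<not> 2 * j + 1 \<le> x"
      moreover have "\<not> x < 2 * k" "x > 0" using that assms(1) by linarith+
      ultimately have "count M x = 0"
        using R by (auto simp: MP_mult_def dest!: spec[of _ x])
      with that show False by (simp add: not_in_iff[symmetric])
    qed
    moreover have "count M x \<le> 1" if "x \<in># M" "odd x" "x \<noteq> 2 * j + 1" for x
    proof -
      have "count M x \<in> MP_mult k j x" using R that(2) by (auto elim: oddE)
      then show ?thesis using that by (auto simp: MP_mult_def pod_mult_def split: if_splits)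
    qed
    moreover have "2 * k - 1 < 2 * j + 1" using R by linarith
    ultimately show "2 * j + 1 \<in># M \<and> Q M (2 * j + 1)"
      using R assms(1) count_greater_zero_iff[of M "2 * j + 1"] by (simp add: Q_def)
  qed
  have "MP k n = card {M. 0 \<notin># M \<and> sum_mset M = n \<and> (\<exists>m\<in>#M. Q M m)}"
    using card_partitions_eq_mset[of n "\<lambda>M. \<exists>m\<in>#M. Q M m"]
    by (simp add: MP_def Q_def count_mset)
  also have "{M. 0 \<notin># M \<and> sum_mset M = n \<and> (\<exists>m\<in>#M. Q M m)}
      = (\<Union>j\<in>{k..<J}. partitions_with (MP_mult k j) n)" (is "?L = ?R")
  proof (intro equalityI subsetI)
    fix M assume M: "M \<in> ?L"
    then obtain m where m: "m \<in># M" "Q M m" by blast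
    then have "odd m" by (simp add: Q_def)
    then obtain j where j: "m = 2 * j + 1" by (elim oddE)
    have "m \<le> n" using m M member_le_sum_mset[of m M] by simp
    with j assms(2) have "j < J" by simp
    moreover have "k \<le> j" "M \<in> partitions_with (MP_mult k j) n"
      using Q_iff[of M j] m j M by (auto simp: partitions_with_def)
    ultimately show "M \<in> ?R" by auto
  next
    fix M assume "M \<in> ?R"
    then obtain j where "k \<le> j" "M \<in> partitions_with (MP_mult k j) n" by auto
    then show "M \<in> ?L" using Q_iff[of M j] by (auto simp: partitions_with_def)
  qed
  also have "card ?R = (\<Sum>j=k..<J. card (partitions_with (MP_mult k j) n))"
  proof (rule card_UN_disjoint)
    have disj: False
      if "M \<in> partitions_with (MP_mult k i) n" "M \<in> partitions_with (MP_mult k j) n" "k \<le> i" "i < j"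
      for M i j
    proof -
      have "MP_mult k i (2 * i + 1) = {k}" "MP_mult k j (2 * i + 1) = {0}"
        using that(3,4) by (simp_all add: MP_mult_def)
      moreover have "count M (2 * i + 1) \<in> MP_mult k i (2 * i + 1)"
        "count M (2 * i + 1) \<in> MP_mult k j (2 * i + 1)"
        using that(1,2) by (simp_all add: partitions_with_def)
      ultimately show False using assms(1) by simp
    qed
    show "\<forall>i\<in>{k..<J}. \<forall>j\<in>{k..<J}. i \<noteq> j \<longrightarrow>
        partitions_with (MP_mult k i) n \<inter> partitions_with (MP_mult k j) n = {}"
    proof (intro ballI impI equals0I)
      fix i j M
      assume "i \<in> {k..<J}" "j \<in> {k..<J}" "i \<noteq> j"
        and "M \<in> partitions_with (MP_mult k i) n \<inter> partitions_with (MP_mult k j) n"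
      then show False using disj[of M i j] disj[of M j i] by (cases i j rule: linorder_cases) auto
    qed
  qed (simp_all add: finite_partitions_with)
  finally show ?thesis .
qed

lemma MP_gf_nth:
  assumes "0 < k" "n \<le> 2 * J"
  shows "MP_gf k $ n = (pod_upto (2 * k - 1) * MP_tail k J) $ n"
proof -
  have "pod_upto (2 * k - 1) * MP_tail k J = (\<Sum>j=k..<J. partition_gf (MP_mult k j))"
    using assms(1) by (simp add: MP_tail_def sum_distrib_left partition_gf_MP_mult)
  then show ?thesis
    using assms by (simp add: MP_gf_def card_MP[of k n J] fps_sum_nth partition_gf_def)
qed

text \<open>The telescoping sum for \<open>k = 0\<close>, where the coefficient \<open>1 - x\<^sup>0\<close> removes the first sum.\<close>
lemma MP_gf_one: "MP_gf 1 = (1 - fps_X) * partition_gf pod_mult - 1"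
proof (rule fps_ext)
  fix n
  define J where "J = Suc n"
  have "pod_upto 0 * ((1 + fps_X) * MP_tail 1 J) = (1 - fps_X) * pod_above 0 - pod_above (2 * J)"
    using MP_tail_telescope[of 0 J] by (simp add: J_def pod_upto_def)
  moreover have "pod_upto 1 = pod_upto 0 * (1 + fps_X)"
    using pod_upto_odd[of 0] by simp
  moreover have "partition_gf pod_mult = pod_above 0"
    using pod_upto_mult_pod_above[of 0] by (simp add: pod_upto_def)
  ultimately have "pod_upto 1 * MP_tail 1 J = (1 - fps_X) * partition_gf pod_mult - pod_above (2 * J)"
    by (simp add: mult_ac)
  then show "MP_gf 1 $ n = ((1 - fps_X) * partition_gf pod_mult - 1) $ n"
    using MP_gf_nth[of 1 n J] by (simp add: J_def pod_above_nth_low)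
qed

text \<open>
  Multiplying \<open>MP_tail_telescope\<close> by \<open>pod_upto (2 k)\<close> turns its left-hand side into the sum of two
  consecutive generating functions, up to the truncation at \<open>J\<close>.  The boundary term at \<open>J\<close>
  starts in degree \<open>k (2 J + 1)\<close>, so it is invisible once \<open>J\<close> is large.
\<close>
lemma MP_gf_add_Suc:
  assumes "0 < k"
  shows "MP_gf k + MP_gf (Suc k)
       = fps_X ^ (k * (2 * k + 1)) * (1 - fps_X ^ (2 * k + 1)) * partition_gf pod_mult"
proof (rule fps_ext)
  fix n
  \<comment> \<open>This gives \<open>k < J\<close> for telescoping and \<open>n \<le> 2 J\<close> for reading off the coefficients.\<close>
  define J where "J = n + k + 1"
  let ?E = "fps_X ^ (k * (2 * J + 1)) * (pod_upto (2 * k) * pod_above (2 * J))"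
  obtain l where l: "k = Suc l" using assms by (cases k) auto
  have upto: "pod_upto (2 * k) * (1 - fps_X ^ (2 * k)) = pod_upto (2 * k - 1)"
    using pod_upto_even[of l] by (simp add: l)
  have odd: "pod_upto (2 * Suc k - 1) = pod_upto (2 * k) * (1 + fps_X ^ (2 * k + 1))"
    using pod_upto_odd[of k] by simp
  have "pod_upto (2 * k - 1) * MP_tail k J + pod_upto (2 * Suc k - 1) * MP_tail (Suc k) J
      = pod_upto (2 * k) * ((1 - fps_X ^ (2 * k)) * MP_tail k J
          + (1 + fps_X ^ (2 * k + 1)) * MP_tail (Suc k) J)"
    unfolding upto[symmetric] odd by (simp only: distrib_left mult_ac)
  also have "\<dots> = fps_X ^ (k * (2 * k + 1)) * (1 - fps_X ^ (2 * k + 1))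
        * (pod_upto (2 * k) * pod_above (2 * k)) - ?E"
    by (subst MP_tail_telescope) (simp_all add: J_def algebra_simps)
  finally have "(pod_upto (2 * k - 1) * MP_tail k J + pod_upto (2 * Suc k - 1) * MP_tail (Suc k) J) $ n
      = (fps_X ^ (k * (2 * k + 1)) * (1 - fps_X ^ (2 * k + 1)) * partition_gf pod_mult - ?E) $ n"
    by (simp only: pod_upto_mult_pod_above[symmetric])
  moreover have "n < k * (2 * J + 1)"
    using assms by (simp add: J_def l)
  then have "?E $ n = 0" by (simp only: fps_X_power_mult_nth if_True)
  ultimately show "(MP_gf k + MP_gf (Suc k)) $ n
      = (fps_X ^ (k * (2 * k + 1)) * (1 - fps_X ^ (2 * k + 1)) * partition_gf pod_mult) $ n"
    using MP_gf_nth[of k n J] MP_gf_nth[of "Suc k" n J] assms by (simp add: J_def)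
qed

section \<open>The truncated theorem of Gauss\<close>

definition gauss_sum :: "nat \<Rightarrow> int fps" where
  "gauss_sum m = (\<Sum>j<m. (-1) ^ (j * (j + 1) div 2) * fps_X ^ (j * (j + 1) div 2))"

text \<open>
  From \<open>k\<close> to \<open>k + 1\<close> the sum gains the terms with the triangular numbers \<open>k (2 k + 1)\<close> and
  \<open>(k + 1) (2 k + 1)\<close>.  Their parities are those of \<open>k\<close> and \<open>k + 1\<close>, so together the new terms are
  \<open>(-1)\<^sup>k\<close> times the factor that \<open>MP_gf_add_Suc\<close> produces.
\<close>
theorem truncated_gauss:
  assumes "0 < k"
  shows "partition_gf pod_mult * gauss_sum (2 * k) = 1 - (-1) ^ k * MP_gf k"
  using assms
proof (induction k rule: nat_induct_non_zero)
  case 1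
  have "gauss_sum 2 = 1 - fps_X"
    by (simp add: gauss_sum_def numeral_2_eq_2)
  then show ?case using MP_gf_one by (simp add: mult_ac)
next
  case (Suc k)
  have T: "2 * k * (2 * k + 1) div 2 = k * (2 * k + 1)"
    "(2 * k + 1) * (2 * k + 1 + 1) div 2 = k * (2 * k + 1) + (2 * k + 1)"
    by (simp_all add: algebra_simps)
  \<comment> \<open>The powers of \<open>x\<close> are replaced by variables, so that ring normalization cannot split them.\<close>
  have collect: "g + s * a + - s * (a * v) = g + s * (a * (1 - v))" for g s a v :: "int fps"
    by (simp add: algebra_simps)
  have sgn: "(-1) ^ (k * (2 * k + 1)) = ((-1) ^ k :: int fps)"
    "(-1) ^ (k * (2 * k + 1) + (2 * k + 1)) = (- ((-1) ^ k) :: int fps)"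
    by (simp_all add: minus_one_power_iff)
  have "gauss_sum (2 * Suc k) = gauss_sum (2 * k)
      + (-1) ^ (2 * k * (2 * k + 1) div 2) * fps_X ^ (2 * k * (2 * k + 1) div 2)
      + (-1) ^ ((2 * k + 1) * (2 * k + 1 + 1) div 2) * fps_X ^ ((2 * k + 1) * (2 * k + 1 + 1) div 2)"
    by (simp add: gauss_sum_def)
  also have "\<dots> = gauss_sum (2 * k) + (-1) ^ k * (fps_X ^ (k * (2 * k + 1)) * (1 - fps_X ^ (2 * k + 1)))"
    unfolding T sgn power_add[of fps_X "k * (2 * k + 1)"] by (simp only: collect)
  finally have step: "gauss_sum (2 * Suc k) = \<dots>" .
  have "partition_gf pod_mult * gauss_sum (2 * Suc k)
      = partition_gf pod_mult * gauss_sum (2 * k)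
        + (-1) ^ k * (fps_X ^ (k * (2 * k + 1)) * (1 - fps_X ^ (2 * k + 1)) * partition_gf pod_mult)"
    unfolding step by (simp only: distrib_left mult_ac)
  also have "\<dots> = 1 - (-1) ^ Suc k * MP_gf (Suc k)"
    unfolding Suc.IH MP_gf_add_Suc[OF Suc.hyps, symmetric] by (simp add: algebra_simps)
  finally show ?case .
qed

section \<open>Partitions into distinct parts not congruent to 2 modulo 4\<close>

definition Q2_mult :: "nat \<Rightarrow> nat set" where
  "Q2_mult i = (if i mod 4 = 2 then {0} else {0, 1})"

lemma fps_compose_X_square_nth:
  fixes f :: "'a::comm_ring_1 fps"
  shows "(f oo fps_X ^ 2) $ n = (if even n then f $ (n div 2) else 0)"
proof -
  have "(f oo fps_X ^ 2) $ n = (\<Sum>i=0..n. if n = 2 * i then f $ i else 0)"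
    unfolding fps_compose_nth power_mult[symmetric]
    by (intro sum.cong) (auto simp: fps_X_power_iff)
  also have "\<dots> = (if even n then f $ (n div 2) else 0)"
  proof (cases "even n")
    case True
    then have "(\<Sum>i=0..n. if n = 2 * i then f $ i else 0) = (\<Sum>i=0..n. if i = n div 2 then f $ i else 0)"
      by (intro sum.cong) auto
    then show ?thesis using True by simp
  next
    case False
    then have "n \<noteq> 2 * i" for i by auto
    then show ?thesis using False by simp
  qed
  finally show ?thesis .
qed

lemma part_gf_compose_X_square: "part_gf i S oo fps_X ^ 2 = part_gf (2 * i) S"
  by (rule fps_ext) (auto simp: fps_compose_X_square_nth part_gf_def mult.assoc elim!: evenE)

text \<open>In terms of partitions: a multiplicity is its remainder modulo 2 plus an even number.\<close>
lemma part_gf_split_double: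
  assumes "i > 0"
  shows "(1 + fps_X ^ i) * part_gf (2 * i) UNIV = part_gf i UNIV"
proof -
  have sq: "fps_X ^ (2 * i) = (fps_X ^ i * fps_X ^ i :: int fps)"
    by (simp add: mult_2 power_add)
  have "(1 + fps_X ^ i) * part_gf (2 * i) UNIV
      = (part_gf i UNIV * (1 - fps_X ^ i)) * ((1 + fps_X ^ i) * part_gf (2 * i) UNIV)"
    using assms by (simp add: part_gf_UNIV)
  also have "\<dots> = part_gf i UNIV * (part_gf (2 * i) UNIV * (1 - fps_X ^ (2 * i)))"
    by (simp only: sq) (simp add: algebra_simps)
  finally show ?thesis using assms by (simp add: part_gf_UNIV)
qed

text \<open>
  The factors match exactly only for a suitable set of part sizes in the second product.  An odd
  size \<open>i\<close> there supplies the factor \<open>1 + q\<^sup>2\<^sup>i\<close> that is missing among the distinct parts because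
  \<open>2 i\<close> is congruent to 2 modulo 4.  An even size \<open>i\<close> supplies the denominator \<open>1 - q\<^sup>2\<^sup>i\<close>, which
  belongs to the part size \<open>i\<close> on the right.  So even sizes have to reach twice as far as odd ones.
\<close>
lemma finite_product_Q2_pod:
  defines "I \<equiv> \<lambda>M. \<Union>j<M. {2 * j + 1, 4 * j + 2, 4 * j + 4}"
  shows "(\<Prod>i=1..4*M. part_gf i (Q2_mult i)) * (\<Prod>i\<in>I M. part_gf (2 * i) (pod_mult i))
       = (\<Prod>i=1..4*M. part_gf i (pod_mult i))"
proof (induction M)
  case 0
  then show ?case by (simp add: I_def)
next
  case (Suc M)
  have four: "(\<Prod>i=1..4 * Suc M. f i)
      = (\<Prod>i=1..4*M. f i) * f (4*M+1) * f (4*M+2) * f (4*M+3) * f (4*M+4)" for f :: "nat \<Rightarrow> int fps"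
    by (simp add: eval_nat_numeral mult_ac)
  have "I (Suc M) = insert (2 * M + 1) (insert (4 * M + 2) (insert (4 * M + 4) (I M)))"
    by (auto simp: I_def lessThan_Suc)
  moreover have "2 * M + 1 \<notin> I M" "4 * M + 2 \<notin> I M" "4 * M + 4 \<notin> I M"
    unfolding I_def by (auto, presburger+)
  moreover have "finite (I M)" by (simp add: I_def)
  ultimately have I: "(\<Prod>i\<in>I (Suc M). f i) = (\<Prod>i\<in>I M. f i) * f (2*M+1) * f (4*M+2) * f (4*M+4)"
    for f :: "nat \<Rightarrow> int fps"
    by (simp add: mult_ac)
  have Q: "part_gf (4*M+1) (Q2_mult (4*M+1)) = 1 + fps_X ^ (4*M+1)"
     "part_gf (4*M+2) (Q2_mult (4*M+2)) = 1"
     "part_gf (4*M+3) (Q2_mult (4*M+3)) = 1 + fps_X ^ (4*M+3)"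
     "part_gf (4*M+4) (Q2_mult (4*M+4)) = 1 + fps_X ^ (4*M+4)"
    by (simp_all add: Q2_mult_def part_gf_zero part_gf_at_most_once[simplified] mod_Suc)
  have P: "part_gf (4*M+1) (pod_mult (4*M+1)) = 1 + fps_X ^ (4*M+1)"
     "part_gf (4*M+2) (pod_mult (4*M+2)) = (1 + fps_X ^ (4*M+2)) * part_gf (2 * (4*M+2)) UNIV"
     "part_gf (4*M+3) (pod_mult (4*M+3)) = 1 + fps_X ^ (4*M+3)"
     "part_gf (4*M+4) (pod_mult (4*M+4)) = (1 + fps_X ^ (4*M+4)) * part_gf (2 * (4*M+4)) UNIV"
     "part_gf (2 * (2*M+1)) (pod_mult (2*M+1)) = 1 + fps_X ^ (4*M+2)"
    using part_gf_split_double[of "4 * M + 2"] part_gf_split_double[of "4 * M + 4"]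
    by (simp_all add: pod_mult_def part_gf_at_most_once[simplified])
  have U: "pod_mult (4*M+2) = UNIV" "pod_mult (4*M+4) = UNIV"
    by (simp_all add: pod_mult_def)
  show ?case
    unfolding four I Q P Suc.IH[symmetric] unfolding U by (simp only: mult_ac mult_1 mult_1_right)
qed

lemma Q2_gf_mult_pod_gf:
  "partition_gf Q2_mult * (partition_gf pod_mult oo fps_X ^ 2) = partition_gf pod_mult"
proof (rule fps_ext)
  fix n
  define I :: "nat set" where "I = (\<Union>j<n. {2 * j + 1, 4 * j + 2, 4 * j + 4})"
  have sub: "{1..2 * n} \<subseteq> I"
  proof
    fix i :: nat assume i: "i \<in> {1..2 * n}"
    have "(\<exists>j. i = 2 * j + 1) \<or> (\<exists>j. i = 4 * j + 2) \<or> (\<exists>j. i = 4 * j + 4)"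
      using i by (simp, presburger)
    then consider j where "i = 2 * j + 1" | j where "i = 4 * j + 2" | j where "i = 4 * j + 4"
      by blast
    then show "i \<in> I"
      using i unfolding I_def by cases (rule UN_I, auto)+
  qed
  have I: "finite I" "0 \<notin> I" by (auto simp: I_def)
  have "partition_gf Q2_mult $ m = (\<Prod>i=1..4*n. part_gf i (Q2_mult i)) $ m" if "m \<le> n" for m
    using that by (intro partition_gf_nth_prod[where N = "4 * n"]) (auto simp: Q2_mult_def)
  moreover have "(partition_gf pod_mult oo fps_X ^ 2) $ m = (\<Prod>i\<in>I. part_gf (2 * i) (pod_mult i)) $ m"
    if "m \<le> n" for m
  proof -
    have "(\<Prod>i\<in>I. part_gf (2 * i) (pod_mult i)) = (\<Prod>i\<in>I. part_gf i (pod_mult i)) oo fps_X ^ 2"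
      by (simp add: fps_compose_prod_distrib part_gf_compose_X_square)
    moreover have "partition_gf pod_mult $ (m div 2) = (\<Prod>i\<in>I. part_gf i (pod_mult i)) $ (m div 2)"
      using that I sub by (intro partition_gf_nth_prod[where N = "2 * n"]) (auto simp: pod_mult_def)
    ultimately show ?thesis by (simp add: fps_compose_X_square_nth)
  qed
  ultimately have "(partition_gf Q2_mult * (partition_gf pod_mult oo fps_X ^ 2)) $ n
      = ((\<Prod>i=1..4*n. part_gf i (Q2_mult i)) * (\<Prod>i\<in>I. part_gf (2 * i) (pod_mult i))) $ n"
    by (intro fps_mult_nth_cong)
  also have "\<dots> = (\<Prod>i=1..4*n. part_gf i (pod_mult i)) $ n"
    unfolding I_def finite_product_Q2_pod ..
  also have "\<dots> = partition_gf pod_mult $ n"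
    by (rule partition_gf_nth_prod[where N = "4 * n", symmetric]) (auto simp: pod_mult_def)
  finally show "(partition_gf Q2_mult * (partition_gf pod_mult oo fps_X ^ 2)) $ n
      = partition_gf pod_mult $ n" .
qed

lemma partition_gf_nth:
  "partition_gf A $ n = int (card {p. is_partition n p \<and> (\<forall>i>0. count_list p i \<in> A i)})"
  using card_partitions_eq_mset[of n "\<lambda>M. \<forall>i>0. count M i \<in> A i"]
  by (simp add: partition_gf_def partitions_with_def count_mset)

lemma partition_gf_pod: "partition_gf pod_mult $ n = int (pod (int n))"
proof -
  have "{p. is_partition n p \<and> (\<forall>x\<in>set p. odd x \<longrightarrow> count_list p x = 1)}
      = {p. is_partition n p \<and> (\<forall>i>0. count_list p i \<in> pod_mult i)}"
  proof (rule Collect_cong, rule conj_cong[OF refl])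
    fix p assume "is_partition n p"
    then show "(\<forall>x\<in>set p. odd x \<longrightarrow> count_list p x = 1)
        \<longleftrightarrow> (\<forall>i>0. count_list p i \<in> pod_mult i)"
      by (auto simp: is_partition_def pod_mult_def count_list_0_iff)
  qed
  then show ?thesis by (simp add: pod_def partition_gf_nth)
qed

lemma partition_gf_Q2: "partition_gf Q2_mult $ n = int (Q2 n)"
proof -
  have "{p. is_partition n p \<and> distinct p \<and> (\<forall>x\<in>set p. x mod 4 \<noteq> 2)}
      = {p. is_partition n p \<and> (\<forall>i>0. count_list p i \<in> Q2_mult i)}"
  proof (rule Collect_cong, rule conj_cong[OF refl])
    fix p assume "is_partition n p"
    then have pos: "\<forall>x\<in>set p. 0 < x" by (simp add: is_partition_def)
    show "distinct p \<and> (\<forall>x\<in>set p. x mod 4 \<noteq> 2)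
        \<longleftrightarrow> (\<forall>i>0. count_list p i \<in> Q2_mult i)"
    proof
      assume "distinct p \<and> (\<forall>x\<in>set p. x mod 4 \<noteq> 2)"
      then show "\<forall>i>0. count_list p i \<in> Q2_mult i"
        by (auto simp: Q2_mult_def distinct_count_atmost_1 count_mset count_list_0_iff)
    next
      assume R: "\<forall>i>0. count_list p i \<in> Q2_mult i"
      have "count_list p x = 1 \<and> x mod 4 \<noteq> 2" if "x \<in> set p" for x
      proof -
        have "count_list p x \<noteq> 0" "count_list p x \<in> Q2_mult x"
          using that pos R by (auto simp: count_list_0_iff)
        then show ?thesis by (auto simp: Q2_mult_def split: if_splits)
      qed
      then show "distinct p \<and> (\<forall>x\<in>set p. x mod 4 \<noteq> 2)"
        by (simp add: distinct_count_atmost_1 count_mset count_list_0_iff)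
    qed
  qed
  then show ?thesis by (simp add: Q2_def partition_gf_nth)
qed

section \<open>The truncated recurrence for pod\<close>

theorem theorem4p3:
  fixes n k :: nat
  assumes "n > 0" and "k > 0"
  shows "(-1) ^ k * (int (Q2 n) -
           (\<Sum>j=0..2*k-1. (-1) ^ (j * (j + 1) div 2) * int (pod (int n - int (j * (j + 1))))))
         = (\<Sum>j=0..n div 2. int (Q2 (n - 2 * j)) * int (MP k j))"
proof -
  let ?P = "partition_gf pod_mult" and ?Q = "partition_gf Q2_mult"
  let ?e = "\<lambda>j. (-1) ^ (j * (j + 1) div 2) :: int"
  define G where "G = (\<Sum>j=0..2*k-1. fps_const (?e j) * fps_X ^ (j * (j + 1)))"
  have "{..<2 * k} = {0..2*k-1}" using assms by auto
  then have "gauss_sum (2 * k)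
      = (\<Sum>j=0..2*k-1. fps_const (?e j) * fps_X ^ (j * (j + 1) div 2))"
    unfolding gauss_sum_def
    by (intro sum.cong) (simp_all flip: fps_const_power fps_const_neg)
  then have gauss: "gauss_sum (2 * k) oo fps_X ^ 2 = G"
    unfolding G_def
    by (simp add: fps_compose_sum_distrib fps_compose_mult_distrib fps_compose_power[symmetric]
        flip: power_mult)
  have sgn: "(-1) ^ k oo h = ((-1) ^ k :: int fps)" for h
    by (cases "even k") (simp_all add: fps_compose_uminus)
  \<comment> \<open>The truncated theorem of Gauss at \<open>q\<^sup>2\<close>, multiplied by the series of \<open>Q\<^sub>2\<close>, evaluated in two ways.\<close>
  have "?Q * ((?P * gauss_sum (2 * k)) oo fps_X ^ 2) = ?P * G"
    by (simp add: fps_compose_mult_distrib gauss flip: mult.assoc) (simp add: Q2_gf_mult_pod_gf)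
  moreover have "(?P * gauss_sum (2 * k)) oo fps_X ^ 2 = 1 - (-1) ^ k * (MP_gf k oo fps_X ^ 2)"
    using assms by (simp add: truncated_gauss fps_compose_sub_distrib fps_compose_mult_distrib sgn)
  ultimately have "?Q * (1 - (-1) ^ k * (MP_gf k oo fps_X ^ 2)) = ?P * G"
    by (simp only:)
  then have "?Q - ?P * G = (-1) ^ k * (?Q * (MP_gf k oo fps_X ^ 2))"
    by (simp add: algebra_simps)
  then have "(-1) ^ k * (?Q - ?P * G) = (MP_gf k oo fps_X ^ 2) * ?Q"
    by (simp add: mult_ac flip: mult.assoc power_mult_distrib)
  then have "(fps_const ((-1) ^ k) * (?Q - ?P * G)) $ n = ((MP_gf k oo fps_X ^ 2) * ?Q) $ n"
    by (simp flip: fps_const_power fps_const_neg)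
  moreover have "(?P * G) $ n = (\<Sum>j=0..2*k-1. ?e j * int (pod (int n - int (j * (j + 1)))))"
  proof -
    have "(?P * (fps_const (?e j) * fps_X ^ (j * (j + 1)))) $ n
        = ?e j * int (pod (int n - int (j * (j + 1))))" for j
    proof -
      have "(?P * (fps_const (?e j) * fps_X ^ (j * (j + 1)))) $ n
          = ?e j * (?P * fps_X ^ (j * (j + 1))) $ n"
        by (metis fps_mult_left_const_nth mult.left_commute)
      also have "(?P * fps_X ^ (j * (j + 1))) $ n = int (pod (int n - int (j * (j + 1))))"
      proof (cases "n < j * (j + 1)")
        case True
        then have "int n - int (j * (j + 1)) < 0" by linarith
        with True show ?thesis by (simp only: fps_X_power_mult_right_nth pod_def if_True)
      next
        case False
        then have "int n - int (j * (j + 1)) = int (n - j * (j + 1))" by linarith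
        with False show ?thesis
          by (simp only: fps_X_power_mult_right_nth partition_gf_pod if_False)
      qed
      finally show ?thesis .
    qed
    then show ?thesis by (simp add: G_def sum_distrib_left fps_sum_nth)
  qed
  moreover have "((MP_gf k oo fps_X ^ 2) * ?Q) $ n
      = (\<Sum>j=0..n div 2. int (Q2 (n - 2 * j)) * int (MP k j))"
  proof -
    have "((MP_gf k oo fps_X ^ 2) * ?Q) $ n
        = (\<Sum>i\<in>{i\<in>{0..n}. even i}. int (MP k (i div 2)) * int (Q2 (n - i)))"
      unfolding fps_mult_nth
      by (intro sum.mono_neutral_cong_right)
         (auto simp: fps_compose_X_square_nth MP_gf_def partition_gf_Q2)
    also have "{i\<in>{0..n}. even i} = (\<lambda>j. 2 * j) ` {0..n div 2}"
      by (auto elim!: evenE)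
    finally show ?thesis by (simp add: sum.reindex inj_on_def mult.commute)
  qed
  ultimately show ?thesis by (simp add: partition_gf_Q2)
qed

end
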